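(* Let $X$ be a locally compact Hausdorff space. Then $(\Gamma(X),\tau_{hco})$ is a Hausdorff topological inverse semigroup.
   Context: $\Gamma(X)$ is the inverse semigroup of all homeomorphisms $f:\mathrm{dom}(f)\to\mathrm{im}(f)$ between open subsets of $X$, under composition of partial maps: $\mathrm{dom}(f\circ g)=\{x\in\mathrm{dom}(g): g(x)\in\mathrm{dom}(f)\}$. A topological inverse semigroup is an inverse semigroup with a topology making multiplication and inversion continuous. For $K\subseteq X$ compact and $V\subseteq X$ open, $\langle K;V\rangle=\{f\in\Gamma(X): K\subseteq\mathrm{dom}(f),\ f(K)\subseteq V\}$ and $\langle K;V\rangle^{-1}=\{f\in\Gamma(X): f^{-1}\in\langle K;V\rangle\}$; $\tau_{ico}$ is the topology on $\Gamma(X)$ generated by all these sets. $CL(X)$ is the set of closed subsets of $X$ (including $\emptyset$) with the Fell topology, whose subbasis consists of $V^-=\{A: A\cap V\neq\emptyset\}$ for $V$ open and $W^+=\{A: A\subseteq W\}$ for $W$ open with $X\setminus W$ compact. Let $\mathsf{D}(f)=X\setminus\mathrm{dom}(f)$ and $\mathsf{I}(f)=X\setminus\mathrm{im}(f)$. The topology $\tau_{hco}$ on $\Gamma(X)$ is generated by $\tau_{ico}$ together with the sets $\mathsf{D}^{-1}(U)$ and $\mathsf{I}^{-1}(U)$ for $U$ Fell-open in $CL(X)$. *)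

theory Defs
  imports "HOL-Analysis.Analysis"
begin

section \<open>Topological inverse semigroups\<close>

definition semigroup_on :: "'s set \<Rightarrow> ('s \<Rightarrow> 's \<Rightarrow> 's) \<Rightarrow> bool" where
  "semigroup_on S m \<longleftrightarrow>
     (\<forall>x\<in>S. \<forall>y\<in>S. m x y \<in> S) \<and>
     (\<forall>x\<in>S. \<forall>y\<in>S. \<forall>z\<in>S. m (m x y) z = m x (m y z))"

definition is_semigroup_inverse :: "'s set \<Rightarrow> ('s \<Rightarrow> 's \<Rightarrow> 's) \<Rightarrow> 's \<Rightarrow> 's \<Rightarrow> bool" where
  "is_semigroup_inverse S m x y \<longleftrightarrow> y \<in> S \<and> m (m x y) x = x \<and> m (m y x) y = y"

definition inverse_semigroup_on :: "'s set \<Rightarrow> ('s \<Rightarrow> 's \<Rightarrow> 's) \<Rightarrow> bool" where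
  "inverse_semigroup_on S m \<longleftrightarrow>
     semigroup_on S m \<and> (\<forall>x\<in>S. \<exists>!y. is_semigroup_inverse S m x y)"

definition semigroup_inverse :: "'s set \<Rightarrow> ('s \<Rightarrow> 's \<Rightarrow> 's) \<Rightarrow> 's \<Rightarrow> 's" where
  "semigroup_inverse S m x = (THE y. is_semigroup_inverse S m x y)"

definition topological_inverse_semigroup :: "'s topology \<Rightarrow> ('s \<Rightarrow> 's \<Rightarrow> 's) \<Rightarrow> bool" where
  "topological_inverse_semigroup T m \<longleftrightarrow>
     inverse_semigroup_on (topspace T) m \<and>
     continuous_map (prod_topology T T) T (\<lambda>(x, y). m x y) \<and>
     continuous_map T T (semigroup_inverse (topspace T) m)"


section \<open>Homeomorphisms between open subsets\<close>

text \<open>Partial maps are functions into the option type. Their composition is the library's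
  \<open>\<circ>\<^sub>m\<close>, whose domain is described by \<open>dom_map_comp_eq\<close> below.\<close>

definition Gamma :: "'a topology \<Rightarrow> ('a \<rightharpoonup> 'a) set" where
  "Gamma X = {f. openin X (dom f) \<and> openin X (ran f) \<and>
     homeomorphic_map (subtopology X (dom f)) (subtopology X (ran f)) (\<lambda>x. the (f x))}"

lemma dom_map_comp_eq: "dom (f \<circ>\<^sub>m g) = {x \<in> dom g. the (g x) \<in> dom f}"
  by (auto simp: map_comp_def split: option.splits)

text \<open>The partial inverse is meaningful for injective partial maps only; all elements of
  \<open>Gamma X\<close> are injective on their domain.\<close>

definition map_inv :: "('a \<rightharpoonup> 'b) \<Rightarrow> ('b \<rightharpoonup> 'a)" where
  "map_inv f = (\<lambda>y. if y \<in> ran f then Some (THE x. f x = Some y) else None)"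

definition co_set :: "'a topology \<Rightarrow> 'a set \<Rightarrow> 'a set \<Rightarrow> ('a \<rightharpoonup> 'a) set" where
  "co_set X K V = {f \<in> Gamma X. K \<subseteq> dom f \<and> (\<lambda>x. the (f x)) ` K \<subseteq> V}"

definition co_set_inv :: "'a topology \<Rightarrow> 'a set \<Rightarrow> 'a set \<Rightarrow> ('a \<rightharpoonup> 'a) set" where
  "co_set_inv X K V = {f \<in> Gamma X. map_inv f \<in> co_set X K V}"

definition tau_ico :: "'a topology \<Rightarrow> ('a \<rightharpoonup> 'a) topology" where
  "tau_ico X = topology_generated_by
     ({co_set X K V |K V. compactin X K \<and> openin X V} \<union>
      {co_set_inv X K V |K V. compactin X K \<and> openin X V})"


section \<open>The Fell topology and the topology \<open>tau_hco\<close>\<close>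

definition fell_topology :: "'a topology \<Rightarrow> 'a set topology" where
  "fell_topology X = topology_generated_by
     ({{A. closedin X A \<and> A \<inter> V \<noteq> {}} |V. openin X V} \<union>
      {{A. closedin X A \<and> A \<subseteq> W} |W. openin X W \<and> compactin X (topspace X - W)})"

definition dom_compl :: "'a topology \<Rightarrow> ('a \<rightharpoonup> 'a) \<Rightarrow> 'a set" where
  "dom_compl X f = topspace X - dom f"

definition ran_compl :: "'a topology \<Rightarrow> ('a \<rightharpoonup> 'a) \<Rightarrow> 'a set" where
  "ran_compl X f = topspace X - ran f"

definition tau_hco :: "'a topology \<Rightarrow> ('a \<rightharpoonup> 'a) topology" where
  "tau_hco X = topology_generated_by
     ({U. openin (tau_ico X) U} \<union>
      {{f \<in> Gamma X. dom_compl X f \<in> U} |U. openin (fell_topology X) U} \<union>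
      {{f \<in> Gamma X. ran_compl X f \<in> U} |U. openin (fell_topology X) U})"

text \<open>The library's \<open>topology_generated_by\<close> takes the union of the generating sets as the
  underlying set. The next three lemmas show that this is the intended set in each case.\<close>

lemma topspace_fell_topology: "topspace (fell_topology X) = {A. closedin X A}"
proof (rule equalityI)
  show "topspace (fell_topology X) \<subseteq> {A. closedin X A}"
    by (auto simp: fell_topology_def)
  show "{A. closedin X A} \<subseteq> topspace (fell_topology X)"
  proof
    fix A assume "A \<in> {A. closedin X A}"
    then have "A \<in> {A. closedin X A \<and> A \<subseteq> topspace X}"
      by (simp add: closedin_subset)
    moreover have "openin X (topspace X) \<and> compactin X (topspace X - topspace X)"
      by simp
    ultimately show "A \<in> topspace (fell_topology X)"
      unfolding fell_topology_def topology_generated_by_topspace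
      by (intro UnionI[of "{A. closedin X A \<and> A \<subseteq> topspace X}"] UnI2 CollectI
          exI[of _ "topspace X"] conjI refl) simp_all
  qed
qed

lemma topspace_tau_ico: "topspace (tau_ico X) = Gamma X"
proof (rule equalityI)
  show "topspace (tau_ico X) \<subseteq> Gamma X"
    by (auto simp: tau_ico_def co_set_def co_set_inv_def)
  have "Gamma X = co_set X {} {}"
    by (simp add: co_set_def)
  then have "openin (tau_ico X) (Gamma X)"
    unfolding tau_ico_def
    by (intro topology_generated_by_Basis UnI1 CollectI exI[of _ "{}"]) simp
  then show "Gamma X \<subseteq> topspace (tau_ico X)"
    by (rule openin_subset)
qed

lemma topspace_tau_hco: "topspace (tau_hco X) = Gamma X"
proof (rule equalityI)
  have "U \<subseteq> Gamma X" if "openin (tau_ico X) U" for U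
    using openin_subset[OF that] by (simp add: topspace_tau_ico)
  then show "topspace (tau_hco X) \<subseteq> Gamma X"
    by (auto simp: tau_hco_def)
  have "openin (tau_ico X) (Gamma X)"
    using openin_topspace[of "tau_ico X"] by (simp add: topspace_tau_ico)
  then have "openin (tau_hco X) (Gamma X)"
    unfolding tau_hco_def by (intro topology_generated_by_Basis UnI1 CollectI)
  then show "Gamma X \<subseteq> topspace (tau_hco X)"
    by (rule openin_subset)
qed

end

theory Submission
  imports Defs
begin

text \<open>
  The compact-open part of the multiplication is the classical argument: if \<open>f \<circ>\<^sub>m g\<close> maps the
  compact set \<open>K\<close> into \<open>V\<close>, then local compactness yields a compact neighbourhood \<open>L\<close> of \<open>g(K)\<close>
  inside the open set \<open>f\<^sup>-\<^sup>1(V)\<close>, and any maps that send \<open>K\<close> into the interior of \<open>L\<close> and \<open>L\<close> into \<open>V\<close>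
  compose to a map that sends \<open>K\<close> into \<open>V\<close> (\<open>openin_mult_co_set\<close>).

  For the Fell part, the preimage of a miss set \<open>W\<^sup>+\<close> under \<open>dom_compl\<close> consists of the maps defined on
  the compact set \<open>topspace X - W\<close>, so it is open in the compact-open topology. Continuity therefore
  has to be checked only for compact-open sets and for hit sets \<open>V\<^sup>-\<close>
  (\<open>continuous_map_into_tau_hco\<close>).
  Suppose then that the open set \<open>V\<close> contains a point \<open>x\<close> at which \<open>f \<circ>\<^sub>m g\<close> is undefined. If \<open>g\<close> is
  undefined at \<open>x\<close>, the hit set of \<open>V\<close> for \<open>g\<close> alone suffices. Otherwise \<open>f\<close> is undefined at \<open>g(x)\<close>,
  and the undefined point of \<open>f\<close> has to be pulled back into \<open>V\<close> uniformly for all maps near \<open>g\<close>.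
  This is possible because the topology also controls inverses: a compact neighbourhood \<open>L\<close> of
  \<open>g(x)\<close> in \<open>g(V)\<close> is carried into \<open>V\<close> by \<open>g\<^sup>-\<^sup>1\<close>, hence by the inverse of every map near \<open>g\<close>
  (\<open>openin_mult_hit\<close>).

  Inversion permutes the generating sets, so it is continuous, and the two remaining kinds of generating
  sets for the multiplication reduce to the former through \<open>(f \<circ>\<^sub>m g)\<^sup>-\<^sup>1 = g\<^sup>-\<^sup>1 \<circ>\<^sub>m f\<^sup>-\<^sup>1\<close>.

  For the Hausdorff property, maps with the same domain are separated at a point as in the
  compact-open topology. If \<open>f\<close> is defined at a point where \<open>g\<close> is not, take a compact neighbourhood
  \<open>L\<close> of that point in the domain of \<open>f\<close>: maps defined on all of \<open>L\<close> are separated from the maps that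
  are, like \<open>g\<close>, undefined somewhere in the interior of \<open>L\<close>.
\<close>


section \<open>Partial homeomorphisms as injective relations\<close>

lemma partial_map_eqI:
  assumes "\<And>x y. f x = Some y \<longleftrightarrow> g x = Some y"
  shows "f = g"
proof
  show "f x = g x" for x
    using assms by (cases "f x"; cases "g x") force+
qed

lemma map_inv_eq_Some_iff:
  assumes "inj_on f (dom f)"
  shows "map_inv f y = Some x \<longleftrightarrow> f x = Some y"
proof -
  have "(THE x. f x = Some y) = x" if "f x = Some y" for x
    using that assms by (intro the_equality) (auto simp: inj_on_def dom_def)
  then show ?thesis
    by (auto simp: map_inv_def ran_def)
qed

text \<open>Images and preimages of open sets become mirror images of each other when written with the
  graph relation \<open>f x = Some y\<close>; inversion then only swaps the two conditions.\<close>

lemma Gamma_iff: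
  "f \<in> Gamma X \<longleftrightarrow>
     dom f \<subseteq> topspace X \<and> ran f \<subseteq> topspace X \<and> inj_on f (dom f) \<and>
     (\<forall>U. openin X U \<longrightarrow> openin X {x. \<exists>y\<in>U. f x = Some y}) \<and>
     (\<forall>U. openin X U \<longrightarrow> openin X {y. \<exists>x\<in>U. f x = Some y})"
  (is "_ \<longleftrightarrow> ?R")
proof
  let ?h = "\<lambda>x. the (f x)"
  assume "f \<in> Gamma X"
  then have d: "openin X (dom f)" and r: "openin X (ran f)"
    and h: "homeomorphic_map (subtopology X (dom f)) (subtopology X (ran f)) ?h"
    by (auto simp: Gamma_def)
  have sub: "dom f \<subseteq> topspace X" "ran f \<subseteq> topspace X"
    using d r openin_subset by auto
  have inj: "inj_on f (dom f)"
    using homeomorphic_imp_injective_map[OF h] sub inj_on_imageI2[of the f "dom f"]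
    by (simp add: Int_absorb1 o_def)
  have pre: "openin X {x. \<exists>y\<in>U. f x = Some y}" if "openin X U" for U
  proof -
    have "openin (subtopology X (ran f)) (U \<inter> ran f)"
      using that by (auto simp: openin_subtopology)
    then have "openin (subtopology X (dom f))
        {x \<in> topspace (subtopology X (dom f)). ?h x \<in> U \<inter> ran f}"
      using h openin_continuous_map_preimage homeomorphic_imp_continuous_map by blast
    moreover have "{x \<in> topspace (subtopology X (dom f)). ?h x \<in> U \<inter> ran f}
        = {x. \<exists>y\<in>U. f x = Some y}"
      using sub by (auto simp: ran_def)
    ultimately show ?thesis
      using d by (metis openin_trans_full)
  qed
  have img: "openin X {y. \<exists>x\<in>U. f x = Some y}" if "openin X U" for U
  proof -
    have "openin (subtopology X (dom f)) (U \<inter> dom f)"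
      using that by (auto simp: openin_subtopology)
    then have "openin (subtopology X (ran f)) (?h ` (U \<inter> dom f))"
      using h homeomorphic_imp_open_map open_map_def by blast
    moreover have "?h ` (U \<inter> dom f) = {y. \<exists>x\<in>U. f x = Some y}"
      by (force simp: image_iff)
    ultimately show ?thesis
      using r by (metis openin_trans_full)
  qed
  show ?R
    using sub inj pre img by blast
next
  let ?h = "\<lambda>x. the (f x)"
  assume R: ?R
  then have sub: "dom f \<subseteq> topspace X" "ran f \<subseteq> topspace X"
    by simp_all
  then have "dom f = {x. \<exists>y\<in>topspace X. f x = Some y}" "ran f = {y. \<exists>x\<in>topspace X. f x = Some y}"
    by (auto simp: ran_def)
  with R have d: "openin X (dom f)" and r: "openin X (ran f)"
    by simp_all
  have "homeomorphic_map (subtopology X (dom f)) (subtopology X (ran f)) ?h"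
  proof (rule bijective_open_imp_homeomorphic_map)
    have "openin (subtopology X (dom f)) {x \<in> dom f. ?h x \<in> U}"
      if U: "openin (subtopology X (ran f)) U" for U
    proof -
      have "openin X U"
        using U r by (metis openin_trans_full)
      moreover have "{x \<in> dom f. ?h x \<in> U} = {x. \<exists>y\<in>U. f x = Some y}"
        by auto
      ultimately show ?thesis
        using R by (intro subset_openin_subtopology) auto
    qed
    then show "continuous_map (subtopology X (dom f)) (subtopology X (ran f)) ?h"
      using sub by (auto simp: continuous_map_def Int_absorb1 intro: ranI)
    show "open_map (subtopology X (dom f)) (subtopology X (ran f)) ?h"
      unfolding open_map_def
    proof (intro allI impI)
      fix U assume U: "openin (subtopology X (dom f)) U"
      then have "openin X U" "U \<subseteq> dom f"
        using openin_trans_full[OF U d] openin_subset[OF U] by auto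
      moreover have "?h ` U = {y. \<exists>x\<in>U. f x = Some y}"
        using \<open>U \<subseteq> dom f\<close> by (force simp: image_iff)
      ultimately show "openin (subtopology X (ran f)) (?h ` U)"
        using R by (intro subset_openin_subtopology) (auto simp: ran_def)
    qed
    show "?h ` topspace (subtopology X (dom f)) = topspace (subtopology X (ran f))"
      using sub by (force simp: Int_absorb1 ran_def image_iff)
    show "inj_on ?h (topspace (subtopology X (dom f)))"
      using R sub by (auto simp: Int_absorb1 inj_on_def dom_def)
  qed
  with d r show "f \<in> Gamma X"
    by (simp add: Gamma_def)
qed

lemma Gamma_preimage_open:
  "f \<in> Gamma X \<Longrightarrow> openin X U \<Longrightarrow> openin X {x. \<exists>y\<in>U. f x = Some y}"
  by (simp add: Gamma_iff)

lemma Gamma_image_open: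
  "f \<in> Gamma X \<Longrightarrow> openin X U \<Longrightarrow> openin X {y. \<exists>x\<in>U. f x = Some y}"
  by (simp add: Gamma_iff)

lemma Gamma_Some_in_topspace:
  "f \<in> Gamma X \<Longrightarrow> f x = Some y \<Longrightarrow> x \<in> topspace X \<and> y \<in> topspace X"
  unfolding Gamma_iff by (blast intro: ranI domI)

lemma Gamma_image_compact:
  assumes "f \<in> Gamma X" "compactin X K" "K \<subseteq> dom f"
  shows "compactin X ((\<lambda>x. the (f x)) ` K)"
proof -
  have "continuous_map (subtopology X (dom f)) (subtopology X (ran f)) (\<lambda>x. the (f x))"
    using assms(1) homeomorphic_imp_continuous_map by (auto simp: Gamma_def)
  moreover have "compactin (subtopology X (dom f)) K"
    using assms by (simp add: compactin_subtopology)
  ultimately show ?thesis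
    using image_compactin compactin_subtopology by blast
qed

lemma Gamma_map_inv_eq_Some_iff [simp]:
  "f \<in> Gamma X \<Longrightarrow> map_inv f y = Some x \<longleftrightarrow> f x = Some y"
  by (simp add: map_inv_eq_Some_iff Gamma_iff)

lemma Gamma_Some_inject:
  "f \<in> Gamma X \<Longrightarrow> f x = Some z \<Longrightarrow> f y = Some z \<Longrightarrow> x = y"
  by (metis Gamma_map_inv_eq_Some_iff option.inject)

lemma dom_map_inv [simp]: "dom (map_inv f) = ran f"
  by (auto simp: map_inv_def split: if_splits)

lemma ran_map_inv [simp]: "f \<in> Gamma X \<Longrightarrow> ran (map_inv f) = dom f"
  by (auto simp: ran_def)

lemma map_inv_in_Gamma [simp]:
  assumes "f \<in> Gamma X"
  shows "map_inv f \<in> Gamma X"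
proof -
  have "inj_on (map_inv f) (dom (map_inv f))"
  proof (rule inj_onI)
    fix y z assume "y \<in> dom (map_inv f)" "map_inv f y = map_inv f z"
    then obtain x where "map_inv f y = Some x" "map_inv f z = Some x"
      by force
    with assms show "y = z"
      by simp
  qed
  with assms show ?thesis
    unfolding Gamma_iff[of "map_inv f"]
    by (simp add: Gamma_preimage_open Gamma_image_open) (simp add: Gamma_iff)
qed

lemma map_inv_map_inv [simp]: "f \<in> Gamma X \<Longrightarrow> map_inv (map_inv f) = f"
  by (rule partial_map_eqI) (simp add: Gamma_map_inv_eq_Some_iff[OF map_inv_in_Gamma])

lemma map_comp_in_Gamma [simp]:
  assumes f: "f \<in> Gamma X" and g: "g \<in> Gamma X"
  shows "f \<circ>\<^sub>m g \<in> Gamma X"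
proof -
  have inj: "inj_on (f \<circ>\<^sub>m g) (dom (f \<circ>\<^sub>m g))"
  proof (rule inj_onI)
    fix x y assume "x \<in> dom (f \<circ>\<^sub>m g)" "(f \<circ>\<^sub>m g) x = (f \<circ>\<^sub>m g) y"
    then obtain z where "(f \<circ>\<^sub>m g) x = Some z" "(f \<circ>\<^sub>m g) y = Some z"
      by force
    then obtain u v where "g x = Some u" "g y = Some v" "f u = Some z" "f v = Some z"
      by (auto simp: map_comp_Some_iff)
    with f g show "x = y"
      using Gamma_Some_inject by metis
  qed
  have pre: "{x. \<exists>y\<in>U. (f \<circ>\<^sub>m g) x = Some y}
      = {x. \<exists>y\<in>{y. \<exists>z\<in>U. f y = Some z}. g x = Some y}" for U
    by (auto simp: map_comp_Some_iff)
  have img: "{y. \<exists>x\<in>U. (f \<circ>\<^sub>m g) x = Some y}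
      = {z. \<exists>y\<in>{y. \<exists>x\<in>U. g x = Some y}. f y = Some z}" for U
    by (auto simp: map_comp_Some_iff)
  have "dom (f \<circ>\<^sub>m g) \<subseteq> topspace X" "ran (f \<circ>\<^sub>m g) \<subseteq> topspace X"
    using f g by (auto simp: ran_def map_comp_Some_iff dest: Gamma_Some_in_topspace)
  with f g inj show ?thesis
    unfolding Gamma_iff[of "f \<circ>\<^sub>m g"] pre img
    by (blast intro: Gamma_preimage_open Gamma_image_open)
qed

lemma map_inv_map_comp:
  assumes "f \<in> Gamma X" "g \<in> Gamma X"
  shows "map_inv (f \<circ>\<^sub>m g) = map_inv g \<circ>\<^sub>m map_inv f"
  using assms
  by (intro partial_map_eqI)
    (auto simp: map_comp_Some_iff Gamma_map_inv_eq_Some_iff[OF map_comp_in_Gamma])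


section \<open>The inverse semigroup of partial homeomorphisms\<close>

lemma map_comp_assoc: "(f \<circ>\<^sub>m g) \<circ>\<^sub>m h = f \<circ>\<^sub>m (g \<circ>\<^sub>m h)"
  by (auto simp: map_comp_def split: option.splits)

lemma map_inv_is_semigroup_inverse:
  assumes "f \<in> Gamma X"
  shows "is_semigroup_inverse (Gamma X) (\<circ>\<^sub>m) f (map_inv f)"
proof -
  have "((f \<circ>\<^sub>m map_inv f) \<circ>\<^sub>m f) x = f x" for x
    using assms by (cases "f x") (auto simp: map_comp_def split: option.splits)
  moreover have "((map_inv f \<circ>\<^sub>m f) \<circ>\<^sub>m map_inv f) y = map_inv f y" for y
    using assms by (cases "map_inv f y") (auto simp: map_comp_def split: option.splits)
  ultimately show ?thesis
    using assms by (auto simp: is_semigroup_inverse_def)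
qed

text \<open>Cancelling the injective \<open>f\<close> in \<open>f g f = f\<close> shows that \<open>g\<close> extends the partial inverse of \<open>f\<close>,
  and the symmetric equation \<open>g f g = g\<close> leaves no room for a proper extension.\<close>

lemma semigroup_inverse_unique:
  assumes f: "f \<in> Gamma X" and inv: "is_semigroup_inverse (Gamma X) (\<circ>\<^sub>m) f g"
  shows "g = map_inv f"
proof -
  have extends: "q y = Some x"
    if p: "p \<in> Gamma X" "(p \<circ>\<^sub>m q) \<circ>\<^sub>m p = p" "p x = Some y" for p q :: "'a \<rightharpoonup> 'a" and x y
  proof -
    have "((p \<circ>\<^sub>m q) \<circ>\<^sub>m p) x = Some y"
      using p by simp
    then obtain x' where "q y = Some x'" "p x' = Some y"
      using p(3) by (auto simp: map_comp_Some_iff)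
    with p show ?thesis
      using Gamma_Some_inject by metis
  qed
  have "g y = Some x \<longleftrightarrow> map_inv f y = Some x" for x y
    using f inv extends[of f g x y] extends[of g f y x] by (auto simp: is_semigroup_inverse_def)
  then show ?thesis
    by (rule partial_map_eqI)
qed

lemma semigroup_inverse_eq_map_inv:
  "f \<in> Gamma X \<Longrightarrow> semigroup_inverse (Gamma X) (\<circ>\<^sub>m) f = map_inv f"
  unfolding semigroup_inverse_def
  by (rule the_equality) (auto intro: map_inv_is_semigroup_inverse semigroup_inverse_unique)

lemma inverse_semigroup_Gamma: "inverse_semigroup_on (Gamma X) (\<circ>\<^sub>m)"
  unfolding inverse_semigroup_on_def semigroup_on_def
  using map_inv_is_semigroup_inverse semigroup_inverse_unique
  by (metis map_comp_assoc map_comp_in_Gamma)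


section \<open>Generating sets of the topology\<close>

lemma in_co_set_iff:
  "f \<in> co_set X K V \<longleftrightarrow> f \<in> Gamma X \<and> (\<forall>x\<in>K. \<exists>y\<in>V. f x = Some y)"
  by (force simp: co_set_def)

text \<open>For open \<open>V\<close> this is the preimage under \<open>dom_compl\<close> of the Fell hit set \<open>V\<^sup>-\<close>.\<close>

definition hit_set :: "'a topology \<Rightarrow> 'a set \<Rightarrow> ('a \<rightharpoonup> 'a) set" where
  "hit_set X V = {f \<in> Gamma X. \<exists>x\<in>V. f x = None}"

definition hit_set_inv :: "'a topology \<Rightarrow> 'a set \<Rightarrow> ('a \<rightharpoonup> 'a) set" where
  "hit_set_inv X V = {f \<in> Gamma X. map_inv f \<in> hit_set X V}"

lemma openin_co_set:
  assumes "compactin X K" "openin X V"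
  shows "openin (tau_hco X) (co_set X K V)" "openin (tau_hco X) (co_set_inv X K V)"
proof -
  have "openin (tau_ico X) (co_set X K V)" "openin (tau_ico X) (co_set_inv X K V)"
    unfolding tau_ico_def by (rule topology_generated_by_Basis; use assms in blast)+
  then show "openin (tau_hco X) (co_set X K V)" "openin (tau_hco X) (co_set_inv X K V)"
    unfolding tau_hco_def by (auto intro!: topology_generated_by_Basis)
qed

lemma dom_compl_closedin: "f \<in> Gamma X \<Longrightarrow> closedin X (dom_compl X f)"
  by (auto simp: Gamma_def dom_compl_def)

lemma ran_compl_eq: "ran_compl X f = dom_compl X (map_inv f)"
  by (simp add: ran_compl_def dom_compl_def)

lemma in_hit_set_iff:
  "openin X V \<Longrightarrow> f \<in> hit_set X V \<longleftrightarrow> f \<in> Gamma X \<and> dom_compl X f \<inter> V \<noteq> {}"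
  using openin_subset[of X V] by (auto simp: hit_set_def dom_compl_def)

lemma openin_hit_set:
  assumes "openin X V"
  shows "openin (tau_hco X) (hit_set X V)" "openin (tau_hco X) (hit_set_inv X V)"
proof -
  let ?U = "{A. closedin X A \<and> A \<inter> V \<noteq> {}}"
  have U: "openin (fell_topology X) ?U"
    unfolding fell_topology_def using assms by (blast intro: topology_generated_by_Basis)
  have "hit_set X V = {f \<in> Gamma X. dom_compl X f \<in> ?U}"
    using assms by (auto simp: in_hit_set_iff dom_compl_closedin)
  moreover have "hit_set_inv X V = {f \<in> Gamma X. ran_compl X f \<in> ?U}"
    using assms by (auto simp: hit_set_inv_def in_hit_set_iff dom_compl_closedin ran_compl_eq)
  ultimately show "openin (tau_hco X) (hit_set X V)" "openin (tau_hco X) (hit_set_inv X V)"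
    unfolding tau_hco_def using U by (blast intro: topology_generated_by_Basis)+
qed

text \<open>A map has its domain complement inside \<open>W\<close> exactly when it is defined on the compact
  complement of \<open>W\<close>, so the preimage of a miss set is one of the generating sets \<open>co_set\<close>.\<close>

lemma continuous_map_dom_compl:
  assumes ran: "\<And>t. t \<in> topspace T \<Longrightarrow> h t \<in> Gamma X"
    and co: "\<And>K V. compactin X K \<Longrightarrow> openin X V \<Longrightarrow> openin T {t \<in> topspace T. h t \<in> co_set X K V}"
    and hit: "\<And>V. openin X V \<Longrightarrow> openin T {t \<in> topspace T. h t \<in> hit_set X V}"
  shows "continuous_map T (fell_topology X) (\<lambda>t. dom_compl X (h t))"
proof -
  have "openin T {t \<in> topspace T. closedin X (dom_compl X (h t)) \<and> dom_compl X (h t) \<inter> V \<noteq> {}}"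
    if "openin X V" for V
    using hit[OF that] that ran
    by (simp add: in_hit_set_iff dom_compl_closedin cong: conj_cong)
  moreover have
    "openin T {t \<in> topspace T. closedin X (dom_compl X (h t)) \<and> dom_compl X (h t) \<subseteq> W}"
    if W: "openin X W" "compactin X (topspace X - W)" for W
  proof -
    have "closedin X (dom_compl X f) \<and> dom_compl X f \<subseteq> W
        \<longleftrightarrow> f \<in> co_set X (topspace X - W) (topspace X)" if "f \<in> Gamma X" for f
      using that dom_compl_closedin[OF that] Gamma_Some_in_topspace[OF that]
      by (auto simp: in_co_set_iff dom_compl_def)
    then show ?thesis
      using co[OF W(2) openin_topspace] ran by (simp cong: conj_cong)
  qed
  moreover have "dom_compl X (h t) \<in> topspace (fell_topology X)" if "t \<in> topspace T" for t
    using ran that by (simp add: topspace_fell_topology dom_compl_closedin)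
  ultimately show ?thesis
    unfolding fell_topology_def continuous_on_generated_topo_iff topology_generated_by_topspace
    by (fastforce simp: vimage_def Int_def conj_commute)
qed

lemma continuous_map_into_tau_hco:
  assumes ran: "\<And>t. t \<in> topspace T \<Longrightarrow> h t \<in> Gamma X"
    and co: "\<And>K V. compactin X K \<Longrightarrow> openin X V \<Longrightarrow> openin T {t \<in> topspace T. h t \<in> co_set X K V}"
    and co_inv: "\<And>K V. compactin X K \<Longrightarrow> openin X V
      \<Longrightarrow> openin T {t \<in> topspace T. h t \<in> co_set_inv X K V}"
    and hit: "\<And>V. openin X V \<Longrightarrow> openin T {t \<in> topspace T. h t \<in> hit_set X V}"
    and hit_inv: "\<And>V. openin X V \<Longrightarrow> openin T {t \<in> topspace T. h t \<in> hit_set_inv X V}"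
  shows "continuous_map T (tau_hco X) h"
proof -
  have ico: "continuous_map T (tau_ico X) h"
    unfolding tau_ico_def
  proof (rule continuous_on_generated_topo)
    show "h ` topspace T \<subseteq> \<Union> ({co_set X K V |K V. compactin X K \<and> openin X V} \<union>
        {co_set_inv X K V |K V. compactin X K \<and> openin X V})"
      using ran topspace_tau_ico[of X]
      unfolding tau_ico_def topology_generated_by_topspace by blast
    fix U
    assume "U \<in> {co_set X K V |K V. compactin X K \<and> openin X V} \<union>
        {co_set_inv X K V |K V. compactin X K \<and> openin X V}"
    then show "openin T (h -` U \<inter> topspace T)"
      using co co_inv by (fastforce simp: vimage_def Int_def conj_commute)
  qed
  have D: "continuous_map T (fell_topology X) (\<lambda>t. dom_compl X (h t))"
    using ran co hit by (rule continuous_map_dom_compl)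
  have I: "continuous_map T (fell_topology X) (\<lambda>t. ran_compl X (h t))"
    unfolding ran_compl_eq
  proof (rule continuous_map_dom_compl)
    show "openin T {t \<in> topspace T. map_inv (h t) \<in> co_set X K V}"
      if "compactin X K" "openin X V" for K V
      using co_inv[OF that] ran by (simp add: co_set_inv_def cong: conj_cong)
    show "openin T {t \<in> topspace T. map_inv (h t) \<in> hit_set X V}" if "openin X V" for V
      using hit_inv[OF that] ran by (simp add: hit_set_inv_def cong: conj_cong)
  qed (simp add: ran)
  show ?thesis
    unfolding tau_hco_def
  proof (rule continuous_on_generated_topo)
    fix U
    assume "U \<in> {U. openin (tau_ico X) U} \<union>
      {{f \<in> Gamma X. dom_compl X f \<in> U} |U. openin (fell_topology X) U} \<union>
      {{f \<in> Gamma X. ran_compl X f \<in> U} |U. openin (fell_topology X) U}"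
    then consider "openin (tau_ico X) U"
      | W where "openin (fell_topology X) W" "U = {f \<in> Gamma X. dom_compl X f \<in> W}"
      | W where "openin (fell_topology X) W" "U = {f \<in> Gamma X. ran_compl X f \<in> W}"
      by blast
    then show "openin T (h -` U \<inter> topspace T)"
    proof cases
      case 1
      then show ?thesis
        using openin_continuous_map_preimage[OF ico]
        by (simp add: vimage_def Int_def conj_commute)
    next
      case 2
      then show ?thesis
        using openin_continuous_map_preimage[OF D] ran
        by (simp add: vimage_def Int_def conj_commute cong: conj_cong)
    next
      case 3
      then show ?thesis
        using openin_continuous_map_preimage[OF I] ran
        by (simp add: vimage_def Int_def conj_commute cong: conj_cong)
    qed
  qed (use ran topspace_tau_hco[of X] in
      \<open>unfold tau_hco_def topology_generated_by_topspace, blast\<close>)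
qed


section \<open>Continuity of inversion and multiplication\<close>

lemma continuous_map_map_inv: "continuous_map (tau_hco X) (tau_hco X) map_inv"
proof (rule continuous_map_into_tau_hco)
  fix K V assume KV: "compactin X K" "openin X V"
  have "{f \<in> topspace (tau_hco X). map_inv f \<in> co_set X K V} = co_set_inv X K V"
    by (auto simp: topspace_tau_hco co_set_inv_def)
  with KV show "openin (tau_hco X) {f \<in> topspace (tau_hco X). map_inv f \<in> co_set X K V}"
    by (simp add: openin_co_set)
  have "{f \<in> topspace (tau_hco X). map_inv f \<in> co_set_inv X K V} = co_set X K V"
    by (auto simp: topspace_tau_hco co_set_inv_def in_co_set_iff)
  with KV show "openin (tau_hco X) {f \<in> topspace (tau_hco X). map_inv f \<in> co_set_inv X K V}"
    by (simp add: openin_co_set)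
next
  fix V assume V: "openin X V"
  have "{f \<in> topspace (tau_hco X). map_inv f \<in> hit_set X V} = hit_set_inv X V"
    by (auto simp: topspace_tau_hco hit_set_inv_def)
  with V show "openin (tau_hco X) {f \<in> topspace (tau_hco X). map_inv f \<in> hit_set X V}"
    by (simp add: openin_hit_set)
  have "{f \<in> topspace (tau_hco X). map_inv f \<in> hit_set_inv X V} = hit_set X V"
    by (auto simp: topspace_tau_hco hit_set_inv_def hit_set_def)
  with V show "openin (tau_hco X) {f \<in> topspace (tau_hco X). map_inv f \<in> hit_set_inv X V}"
    by (simp add: openin_hit_set)
qed (simp add: topspace_tau_hco)

text \<open>Open subspaces of a locally compact Hausdorff space are again locally compact, so the compact
  neighbourhood can be taken inside the subspace \<open>U\<close>.\<close>

lemma compact_neighbourhood_in_open: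
  assumes "locally_compact_space X" "Hausdorff_space X"
    and K: "compactin X K" and U: "openin X U" "K \<subseteq> U"
  obtains V L where "openin X V" "compactin X L" "K \<subseteq> V" "V \<subseteq> L" "L \<subseteq> U"
proof -
  have "locally_compact_space (subtopology X U)" "Hausdorff_space (subtopology X U)"
    using assms by (simp_all add: locally_compact_space_open_subset Hausdorff_space_subtopology)
  moreover have "compactin (subtopology X U) K"
    using K U by (simp add: compactin_subtopology)
  ultimately obtain V L where "openin (subtopology X U) V" "compactin (subtopology X U) L"
    "K \<subseteq> V" "V \<subseteq> L"
    using locally_compact_space_compact_closed_compact by metis
  with U that show thesis
    by (metis compactin_subtopology openin_trans_full)
qed

text \<open>The image \<open>g(K)\<close> is compact and lies in the open set of points that \<open>f\<close> maps into \<open>V\<close>. A compact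
  neighbourhood \<open>L\<close> between them leaves room to move \<open>g\<close> and \<open>f\<close> independently.\<close>

lemma openin_mult_co_set:
  assumes X: "locally_compact_space X" "Hausdorff_space X"
    and K: "compactin X K" and V: "openin X V"
  shows "openin (prod_topology (tau_hco X) (tau_hco X))
    {(f, g). f \<in> Gamma X \<and> g \<in> Gamma X \<and> f \<circ>\<^sub>m g \<in> co_set X K V}"
  unfolding openin_prod_topology_alt
proof clarify
  fix f g assume f: "f \<in> Gamma X" and g: "g \<in> Gamma X" and fg: "f \<circ>\<^sub>m g \<in> co_set X K V"
  let ?gK = "(\<lambda>x. the (g x)) ` K" and ?P = "{y. \<exists>z\<in>V. f y = Some z}"
  have gK: "\<exists>y\<in>?P. g x = Some y" if "x \<in> K" for x
    using fg that by (fastforce simp: in_co_set_iff map_comp_Some_iff)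
  have "K \<subseteq> dom g"
    by (blast intro: domI dest: gK)
  with g K have "compactin X ?gK"
    by (rule Gamma_image_compact)
  moreover have "?gK \<subseteq> ?P"
    by (rule image_subsetI) (use gK in force)
  ultimately obtain W L where WL: "openin X W" "compactin X L" "?gK \<subseteq> W" "W \<subseteq> L" "L \<subseteq> ?P"
    by (rule compact_neighbourhood_in_open[OF X _ Gamma_preimage_open[OF f V]])
  show "\<exists>A B. openin (tau_hco X) A \<and> openin (tau_hco X) B \<and> f \<in> A \<and> g \<in> B \<and>
      A \<times> B \<subseteq> {(f, g). f \<in> Gamma X \<and> g \<in> Gamma X \<and> f \<circ>\<^sub>m g \<in> co_set X K V}"
  proof (intro exI conjI)
    show "openin (tau_hco X) (co_set X L V)" "openin (tau_hco X) (co_set X K W)"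
      using openin_co_set WL K V by auto
    show "f \<in> co_set X L V"
      using f WL by (auto simp: in_co_set_iff)
    show "g \<in> co_set X K W"
      using g gK WL by (fastforce simp: in_co_set_iff)
    show "co_set X L V \<times> co_set X K W
        \<subseteq> {(f, g). f \<in> Gamma X \<and> g \<in> Gamma X \<and> f \<circ>\<^sub>m g \<in> co_set X K V}"
      using WL by (fastforce simp: in_co_set_iff map_comp_Some_iff)
  qed
qed

text \<open>A product is undefined at \<open>x\<close> either because \<open>g\<close> is undefined there, or because \<open>f\<close> is undefined at
  \<open>g(x)\<close>. In the second case a nearby \<open>f'\<close> has an undefined point \<open>y'\<close> somewhere near \<open>g(x)\<close>, not
  at a predictable place; controlling \<open>g'\<^sup>-\<^sup>1\<close> on a whole compact neighbourhood of \<open>g(x)\<close> guarantees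
  that \<open>y'\<close> has a preimage in \<open>V\<close> under every nearby \<open>g'\<close>.\<close>

lemma openin_mult_hit:
  assumes X: "locally_compact_space X" "Hausdorff_space X" and V: "openin X V"
  shows "openin (prod_topology (tau_hco X) (tau_hco X))
    {(f, g). f \<in> Gamma X \<and> g \<in> Gamma X \<and> f \<circ>\<^sub>m g \<in> hit_set X V}"
  unfolding openin_prod_topology_alt
proof clarify
  fix f g assume f: "f \<in> Gamma X" and g: "g \<in> Gamma X" and "f \<circ>\<^sub>m g \<in> hit_set X V"
  then obtain x where x: "x \<in> V" "(f \<circ>\<^sub>m g) x = None"
    by (auto simp: hit_set_def)
  show "\<exists>A B. openin (tau_hco X) A \<and> openin (tau_hco X) B \<and> f \<in> A \<and> g \<in> B \<and>
      A \<times> B \<subseteq> {(f, g). f \<in> Gamma X \<and> g \<in> Gamma X \<and> f \<circ>\<^sub>m g \<in> hit_set X V}"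
  proof (cases "g x")
    case None
    show ?thesis
    proof (intro exI conjI)
      show "openin (tau_hco X) (Gamma X)"
        by (metis openin_topspace topspace_tau_hco)
      show "openin (tau_hco X) (hit_set X V)"
        by (rule openin_hit_set[OF V])
      show "f \<in> Gamma X" "g \<in> hit_set X V"
        using f g x None by (auto simp: hit_set_def)
      show "Gamma X \<times> hit_set X V
          \<subseteq> {(f, g). f \<in> Gamma X \<and> g \<in> Gamma X \<and> f \<circ>\<^sub>m g \<in> hit_set X V}"
        by (auto simp: hit_set_def intro!: bexI)
    qed
  next
    case (Some y)
    let ?gV = "{y. \<exists>x\<in>V. g x = Some y}"
    have gV: "openin X ?gV" "y \<in> ?gV"
      using Gamma_image_open[OF g V] x Some by auto
    then have "compactin X {y}"
      using openin_subset by fastforce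
    with gV obtain W L where WL: "openin X W" "compactin X L" "y \<in> W" "W \<subseteq> L" "L \<subseteq> ?gV"
      using compact_neighbourhood_in_open[OF X, of "{y}" ?gV] by auto
    show ?thesis
    proof (intro exI conjI)
      show "openin (tau_hco X) (hit_set X W)" "openin (tau_hco X) (co_set_inv X L V)"
        using WL V openin_hit_set openin_co_set by auto
      show "f \<in> hit_set X W"
        using f x Some WL by (auto simp: hit_set_def map_comp_def)
      show "g \<in> co_set_inv X L V"
        using g WL by (auto simp: co_set_inv_def in_co_set_iff)
      have "f' \<circ>\<^sub>m g' \<in> hit_set X V"
        if f': "f' \<in> hit_set X W" and g': "g' \<in> co_set_inv X L V" for f' g'
      proof -
        from f' obtain y' where y': "y' \<in> L" "f' y' = None"
          using WL by (auto simp: hit_set_def)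
        with g' obtain x' where "x' \<in> V" "g' x' = Some y'"
          by (auto simp: co_set_inv_def in_co_set_iff)
        with f' g' y' show ?thesis
          by (auto simp: hit_set_def co_set_inv_def intro!: bexI[of _ x'])
      qed
      then show "hit_set X W \<times> co_set_inv X L V
          \<subseteq> {(f, g). f \<in> Gamma X \<and> g \<in> Gamma X \<and> f \<circ>\<^sub>m g \<in> hit_set X V}"
        by (auto simp: hit_set_def co_set_inv_def)
    qed
  qed
qed

lemma continuous_map_mult:
  assumes X: "locally_compact_space X" "Hausdorff_space X"
  shows "continuous_map (prod_topology (tau_hco X) (tau_hco X)) (tau_hco X) (\<lambda>(f, g). f \<circ>\<^sub>m g)"
proof -
  let ?T = "prod_topology (tau_hco X) (tau_hco X)"
  have top: "topspace ?T = Gamma X \<times> Gamma X"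
    by (simp add: topspace_tau_hco)
  have swap: "continuous_map ?T ?T (\<lambda>p. (map_inv (snd p), map_inv (fst p)))"
    by (intro continuous_map_pairedI
        continuous_map_compose[OF continuous_map_snd continuous_map_map_inv, unfolded o_def]
        continuous_map_compose[OF continuous_map_fst continuous_map_map_inv, unfolded o_def])
  \<comment> \<open>Statements about \<open>(f \<circ>\<^sub>m g)\<^sup>-\<^sup>1\<close> are pulled back from statements about products along the
    continuous map \<open>(f, g) \<mapsto> (g\<^sup>-\<^sup>1, f\<^sup>-\<^sup>1)\<close>.\<close>
  have pullback: "openin ?T {(f, g). f \<in> Gamma X \<and> g \<in> Gamma X \<and> map_inv (f \<circ>\<^sub>m g) \<in> S}"
    if "openin ?T {(f, g). f \<in> Gamma X \<and> g \<in> Gamma X \<and> f \<circ>\<^sub>m g \<in> S}" for S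
  proof -
    have "{p \<in> topspace ?T. (map_inv (snd p), map_inv (fst p))
          \<in> {(f, g). f \<in> Gamma X \<and> g \<in> Gamma X \<and> f \<circ>\<^sub>m g \<in> S}}
        = {(f, g). f \<in> Gamma X \<and> g \<in> Gamma X \<and> map_inv (f \<circ>\<^sub>m g) \<in> S}"
      unfolding top by (auto simp: map_inv_map_comp)
    then show ?thesis
      using openin_continuous_map_preimage[OF swap that] by simp
  qed
  have shape: "{p \<in> topspace ?T. (case p of (f, g) \<Rightarrow> f \<circ>\<^sub>m g) \<in> S}
      = {(f, g). f \<in> Gamma X \<and> g \<in> Gamma X \<and> f \<circ>\<^sub>m g \<in> S}" for S
    unfolding top by auto
  show ?thesis
  proof (rule continuous_map_into_tau_hco, unfold shape)
    fix K V assume KV: "compactin X K" "openin X V"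
    show *: "openin ?T {(f, g). f \<in> Gamma X \<and> g \<in> Gamma X \<and> f \<circ>\<^sub>m g \<in> co_set X K V}"
      using X KV by (rule openin_mult_co_set)
    show "openin ?T {(f, g). f \<in> Gamma X \<and> g \<in> Gamma X \<and> f \<circ>\<^sub>m g \<in> co_set_inv X K V}"
      using pullback[OF *] by (simp add: co_set_inv_def cong: conj_cong)
  next
    fix V assume V: "openin X V"
    show *: "openin ?T {(f, g). f \<in> Gamma X \<and> g \<in> Gamma X \<and> f \<circ>\<^sub>m g \<in> hit_set X V}"
      using X V by (rule openin_mult_hit)
    show "openin ?T {(f, g). f \<in> Gamma X \<and> g \<in> Gamma X \<and> f \<circ>\<^sub>m g \<in> hit_set_inv X V}"
      using pullback[OF *] by (simp add: hit_set_inv_def cong: conj_cong)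
  qed (auto simp: topspace_tau_hco)
qed


section \<open>Separation\<close>

lemma separate_different_domains:
  assumes X: "locally_compact_space X" "Hausdorff_space X"
    and f: "f \<in> Gamma X" and g: "g \<in> Gamma X" and x: "f x = Some y" "g x = None"
  shows "\<exists>A B. openin (tau_hco X) A \<and> openin (tau_hco X) B \<and> f \<in> A \<and> g \<in> B \<and> disjnt A B"
proof -
  have "openin X (dom f)" "x \<in> dom f"
    using f x by (auto simp: Gamma_def)
  moreover from this have "compactin X {x}"
    using openin_subset by fastforce
  ultimately obtain W L where WL: "openin X W" "compactin X L" "x \<in> W" "W \<subseteq> L" "L \<subseteq> dom f"
    using compact_neighbourhood_in_open[OF X, of "{x}" "dom f"] by auto
  show ?thesis
  proof (intro exI conjI)
    show "openin (tau_hco X) (co_set X L (topspace X))" "openin (tau_hco X) (hit_set X W)"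
      using WL by (auto intro: openin_co_set openin_hit_set)
    show "f \<in> co_set X L (topspace X)"
      using f WL(5) Gamma_Some_in_topspace[OF f] by (force simp: in_co_set_iff)
    show "g \<in> hit_set X W"
      using g x WL by (auto simp: hit_set_def)
    show "disjnt (co_set X L (topspace X)) (hit_set X W)"
      unfolding disjnt_iff in_co_set_iff hit_set_def using WL(4) by force
  qed
qed

lemma separate_different_values:
  assumes X: "Hausdorff_space X"
    and f: "f \<in> Gamma X" and g: "g \<in> Gamma X" and x: "f x = Some y" "g x = Some z" "y \<noteq> z"
  shows "\<exists>A B. openin (tau_hco X) A \<and> openin (tau_hco X) B \<and> f \<in> A \<and> g \<in> B \<and> disjnt A B"
proof -
  have "x \<in> topspace X" "y \<in> topspace X" "z \<in> topspace X"
    using Gamma_Some_in_topspace f g x by metis+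
  then obtain V W where VW: "openin X V" "openin X W" "y \<in> V" "z \<in> W" "disjnt V W"
    using X x(3) unfolding Hausdorff_space_def by metis
  show ?thesis
  proof (intro exI conjI)
    show "openin (tau_hco X) (co_set X {x} V)" "openin (tau_hco X) (co_set X {x} W)"
      using VW \<open>x \<in> topspace X\<close> by (auto intro: openin_co_set)
    show "f \<in> co_set X {x} V" "g \<in> co_set X {x} W"
      using f g x VW by (auto simp: in_co_set_iff)
    show "disjnt (co_set X {x} V) (co_set X {x} W)"
      using VW by (auto simp: disjnt_iff in_co_set_iff)
  qed
qed

lemma Hausdorff_space_tau_hco:
  assumes X: "locally_compact_space X" "Hausdorff_space X"
  shows "Hausdorff_space (tau_hco X)"
  unfolding Hausdorff_space_def topspace_tau_hco
proof (intro allI impI)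
  fix f g assume "f \<in> Gamma X \<and> g \<in> Gamma X \<and> f \<noteq> g"
  then have f: "f \<in> Gamma X" and g: "g \<in> Gamma X" and "f \<noteq> g"
    by auto
  then obtain x where x: "f x \<noteq> g x"
    by auto
  then consider y where "f x = Some y" "g x = None" | y where "f x = None" "g x = Some y"
    | y z where "f x = Some y" "g x = Some z" "y \<noteq> z"
    by (cases "f x"; cases "g x") auto
  then show "\<exists>A B. openin (tau_hco X) A \<and> openin (tau_hco X) B \<and> f \<in> A \<and> g \<in> B \<and> disjnt A B"
  proof cases
    case 1
    with X f g show ?thesis
      by (rule separate_different_domains)
  next
    case 2
    with separate_different_domains[OF X g f] show ?thesis
      by (metis disjnt_sym)
  next
    case 3
    with X(2) f g show ?thesis
      by (rule separate_different_values)
  qed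
qed

theorem proposition3p10:
  fixes X :: "'a topology"
  assumes "locally_compact_space X"
    and "Hausdorff_space X"
  shows "Hausdorff_space (tau_hco X) \<and>
         topological_inverse_semigroup (tau_hco X) (\<circ>\<^sub>m)"
proof -
  have "continuous_map (tau_hco X) (tau_hco X) (semigroup_inverse (Gamma X) (\<circ>\<^sub>m))"
    using continuous_map_map_inv
    by (rule continuous_map_eq) (simp add: topspace_tau_hco semigroup_inverse_eq_map_inv)
  with assms show ?thesis
    by (simp add: topological_inverse_semigroup_def topspace_tau_hco inverse_semigroup_Gamma
        continuous_map_mult Hausdorff_space_tau_hco)
qed

end
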